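(* Let $X$ be a connected graph without loops and multiple edges. The topological space $(VX\cup\Omega_{\mathrm{V}}X,\tau_{\mathrm{V}}X)$ is compact and satisfies the $T_0$ separation axiom.
   Context: For a set of vertices $e\subseteq VX$ write $e^{*}=VX\setminus e$. The vertex-boundary $\theta e$ is the set of vertices of $e^{*}$ adjacent to some vertex of $e$. A vertex-cut is a nonempty set $e\subseteq VX$ with $\theta e$ finite. A ray is a sequence $(x_n)_{n\in\mathbb N}$ of pairwise distinct vertices with $x_n$ adjacent to $x_{n+1}$ for all $n$. A ray lies in $e$ if all but finitely many of its vertices belong to $e$. Two rays are separated by $e$ if one lies in $e$ and the other lies in $e^{*}$. Two rays are vertex-equivalent if no vertex-cut separates them; this is an equivalence relation, and its classes are the vertex-ends of $X$. A vertex-end lies in $e$ if all its rays lie in $e$; $\Omega_{\mathrm{V}}e$ denotes the set of vertex-ends lying in $e$, and $\Omega_{\mathrm{V}}X=\Omega_{\mathrm{V}}VX$. The vertex-topology $\tau_{\mathrm{V}}X$ on $VX\cup\Omega_{\mathrm{V}}X$ is the topology generated by the base $B_{\mathrm{V}}X=\{e\cup\Omega_{\mathrm{V}}e\mid e\subseteq VX,\ |\theta e|<\infty\}$. *)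

theory Defs
  imports "HOL-Analysis.Analysis"
begin

text \<open>A graph without loops and multiple edges is given by a (possibly infinite) vertex set
  and a set of two-element subsets of it.\<close>

definition simple_graph :: "'v set \<Rightarrow> 'v set set \<Rightarrow> bool" where
  "simple_graph V E \<longleftrightarrow> (\<forall>d\<in>E. d \<subseteq> V \<and> card d = 2)"

definition adjacent :: "'v set set \<Rightarrow> 'v \<Rightarrow> 'v \<Rightarrow> bool" where
  "adjacent E u v \<longleftrightarrow> {u, v} \<in> E"

definition connected_graph :: "'v set \<Rightarrow> 'v set set \<Rightarrow> bool" where
  "connected_graph V E \<longleftrightarrow> (\<forall>u\<in>V. \<forall>v\<in>V. (adjacent E)\<^sup>*\<^sup>* u v)"

definition vertex_boundary :: "'v set \<Rightarrow> 'v set set \<Rightarrow> 'v set \<Rightarrow> 'v set" where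
  "vertex_boundary V E e = {v \<in> V - e. \<exists>u\<in>e. adjacent E u v}"

definition vertex_cut :: "'v set \<Rightarrow> 'v set set \<Rightarrow> 'v set \<Rightarrow> bool" where
  "vertex_cut V E e \<longleftrightarrow> e \<noteq> {} \<and> e \<subseteq> V \<and> finite (vertex_boundary V E e)"

definition rays :: "'v set \<Rightarrow> 'v set set \<Rightarrow> (nat \<Rightarrow> 'v) set" where
  "rays V E = {x. range x \<subseteq> V \<and> inj x \<and> (\<forall>n. adjacent E (x n) (x (Suc n)))}"

text \<open>Rays are injective, so finitely many exceptional vertices are the same as finitely many
  exceptional indices.\<close>

definition ray_lies_in :: "(nat \<Rightarrow> 'v) \<Rightarrow> 'v set \<Rightarrow> bool" where
  "ray_lies_in x e \<longleftrightarrow> finite {n. x n \<notin> e}"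

definition separates :: "'v set \<Rightarrow> 'v set \<Rightarrow> (nat \<Rightarrow> 'v) \<Rightarrow> (nat \<Rightarrow> 'v) \<Rightarrow> bool" where
  "separates V e x y \<longleftrightarrow>
     ray_lies_in x e \<and> ray_lies_in y (V - e) \<or> ray_lies_in y e \<and> ray_lies_in x (V - e)"

definition vertex_equivalence ::
    "'v set \<Rightarrow> 'v set set \<Rightarrow> ((nat \<Rightarrow> 'v) \<times> (nat \<Rightarrow> 'v)) set" where
  "vertex_equivalence V E =
     {(x, y) \<in> rays V E \<times> rays V E. \<not> (\<exists>e. vertex_cut V E e \<and> separates V e x y)}"

definition vertex_ends :: "'v set \<Rightarrow> 'v set set \<Rightarrow> (nat \<Rightarrow> 'v) set set" where
  "vertex_ends V E = rays V E // vertex_equivalence V E"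

definition ends_in :: "'v set \<Rightarrow> 'v set set \<Rightarrow> 'v set \<Rightarrow> (nat \<Rightarrow> 'v) set set" where
  "ends_in V E e = {\<omega> \<in> vertex_ends V E. \<forall>x\<in>\<omega>. ray_lies_in x e}"

text \<open>The disjoint union of the vertices and the vertex-ends is formed in a sum type.\<close>

definition vertex_base :: "'v set \<Rightarrow> 'v set set \<Rightarrow> ('v + (nat \<Rightarrow> 'v) set) set set" where
  "vertex_base V E =
     {Inl ` e \<union> Inr ` ends_in V E e |e. e \<subseteq> V \<and> finite (vertex_boundary V E e)}"

definition vertex_topology :: "'v set \<Rightarrow> 'v set set \<Rightarrow> ('v + (nat \<Rightarrow> 'v) set) topology" where
  "vertex_topology V E = topology_generated_by (vertex_base V E)"

lemma ray_lies_in_or_complement: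
  assumes "x \<in> rays V E" "finite (vertex_boundary V E e)"
  shows "ray_lies_in x e \<or> ray_lies_in x (V - e)"
proof -
  have inj: "inj x" and adj: "\<And>n. adjacent E (x n) (x (Suc n))" and V: "\<And>n. x n \<in> V"
    using assms(1) by (auto simp: rays_def)
  have "finite {n. x n \<in> vertex_boundary V E e}"
    using finite_vimageI[OF assms(2) inj] by (simp add: vimage_def)
  then obtain N where N: "\<And>n. x n \<in> vertex_boundary V E e \<Longrightarrow> n < N"
    using finite_nat_set_iff_bounded by auto
  have enter: "x (Suc n) \<in> e" if "x n \<in> e" "n \<ge> N" for n
  proof (rule ccontr)
    assume "x (Suc n) \<notin> e"
    then have "x (Suc n) \<in> vertex_boundary V E e"
      using that adj V by (auto simp: vertex_boundary_def)
    then show False using N that(2) by fastforce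
  qed
  show ?thesis
  proof (cases "\<exists>m\<ge>N. x m \<in> e")
    case True
    then obtain m where m: "m \<ge> N" "x m \<in> e" by blast
    have "x n \<in> e" if "n \<ge> m" for n
      using that
    proof (induction n rule: dec_induct)
      case base
      show ?case by (rule m(2))
    next
      case (step k)
      then show ?case using m(1) enter by simp
    qed
    then have "{n. x n \<notin> e} \<subseteq> {..<m}" using not_le by auto
    then show ?thesis unfolding ray_lies_in_def using finite_subset by blast
  next
    case False
    then have "{n. x n \<notin> V - e} \<subseteq> {..<N}" using V not_le by auto
    then show ?thesis unfolding ray_lies_in_def using finite_subset by blast
  qed
qed

lemma ray_not_lies_in_both:
  assumes "ray_lies_in x e" "ray_lies_in x (V - e)"
  shows False
proof -
  have "UNIV = {n. x n \<notin> e} \<union> {n. x n \<notin> V - e}" by auto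
  then show False using assms unfolding ray_lies_in_def
    by (metis finite_UnI infinite_UNIV_nat)
qed

lemma equiv_vertex_equivalence: "equiv (rays V E) (vertex_equivalence V E)"
proof (rule equivI)
  show "vertex_equivalence V E \<subseteq> rays V E \<times> rays V E"
    by (auto simp: vertex_equivalence_def)
  show "refl_on (rays V E) (vertex_equivalence V E)"
    unfolding refl_on_def vertex_equivalence_def separates_def
    using ray_not_lies_in_both by blast
  show "sym (vertex_equivalence V E)"
    by (auto simp: sym_def vertex_equivalence_def separates_def)
  show "trans (vertex_equivalence V E)"
  proof (rule transI)
    fix x y z
    assume xy: "(x, y) \<in> vertex_equivalence V E" and yz: "(y, z) \<in> vertex_equivalence V E"
    have "\<not> separates V e x z" if e: "vertex_cut V E e" for e
    proof -
      have "y \<in> rays V E" using xy by (auto simp: vertex_equivalence_def)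
      then have "ray_lies_in y e \<or> ray_lies_in y (V - e)"
        using e ray_lies_in_or_complement unfolding vertex_cut_def by blast
      moreover have "\<not> separates V e x y" "\<not> separates V e y z"
        using xy yz e by (auto simp: vertex_equivalence_def)
      ultimately show ?thesis unfolding separates_def by blast
    qed
    then show "(x, z) \<in> vertex_equivalence V E"
      using xy yz by (auto simp: vertex_equivalence_def)
  qed
qed

lemma ends_in_carrier: "ends_in V E V = vertex_ends V E"
proof -
  have "ray_lies_in x V" if "\<omega> \<in> vertex_ends V E" "x \<in> \<omega>" for \<omega> x
    using that
    by (auto simp: vertex_ends_def quotient_def vertex_equivalence_def rays_def ray_lies_in_def
        image_subset_iff)
  then show ?thesis by (auto simp: ends_in_def)
qed

lemma topspace_vertex_topology:
  "topspace (vertex_topology V E) = Inl ` V \<union> Inr ` vertex_ends V E"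
proof -
  have "Inl ` V \<union> Inr ` vertex_ends V E \<in> vertex_base V E"
    unfolding vertex_base_def
    by (rule CollectI, rule exI[of _ V]) (auto simp: ends_in_carrier vertex_boundary_def)
  moreover have "W \<subseteq> Inl ` V \<union> Inr ` vertex_ends V E" if "W \<in> vertex_base V E" for W
    using that by (auto simp: vertex_base_def ends_in_def)
  ultimately show ?thesis
    unfolding vertex_topology_def topology_generated_by_topspace by blast
qed

lemma vertex_base_Int:
  assumes "A \<in> vertex_base V E" "B \<in> vertex_base V E"
  shows "A \<inter> B \<in> vertex_base V E"
proof -
  obtain e f where e: "A = Inl ` e \<union> Inr ` ends_in V E e" "e \<subseteq> V"
      "finite (vertex_boundary V E e)"
    and f: "B = Inl ` f \<union> Inr ` ends_in V E f" "f \<subseteq> V" "finite (vertex_boundary V E f)"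
    using assms by (auto simp: vertex_base_def)
  have "vertex_boundary V E (e \<inter> f) \<subseteq> vertex_boundary V E e \<union> vertex_boundary V E f"
    by (auto simp: vertex_boundary_def)
  then have fin: "finite (vertex_boundary V E (e \<inter> f))"
    using e(3) f(3) by (meson finite_UnI finite_subset)
  have "ray_lies_in x (e \<inter> f) \<longleftrightarrow> ray_lies_in x e \<and> ray_lies_in x f" for x
  proof -
    have "{n. x n \<notin> e \<inter> f} = {n. x n \<notin> e} \<union> {n. x n \<notin> f}" by auto
    then show ?thesis by (simp add: ray_lies_in_def del: Int_iff)
  qed
  then have "ends_in V E (e \<inter> f) = ends_in V E e \<inter> ends_in V E f"
    by (auto simp: ends_in_def)
  then have "A \<inter> B = Inl ` (e \<inter> f) \<union> Inr ` ends_in V E (e \<inter> f)"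
    using e(1) f(1) by auto
  then show ?thesis using fin e(2) unfolding vertex_base_def by blast
qed

lemma openin_vertex_topology:
  "openin (vertex_topology V E) U \<longleftrightarrow> (\<exists>\<U> \<subseteq> vertex_base V E. U = \<Union>\<U>)"
proof
  assume "openin (vertex_topology V E) U"
  then have "generate_topology_on (vertex_base V E) U"
    by (simp add: vertex_topology_def openin_topology_generated_by_iff)
  then have "\<forall>p\<in>U. \<exists>W\<in>vertex_base V E. p \<in> W \<and> W \<subseteq> U"
  proof (induction rule: generate_topology_on.induct)
    case (Int a b)
    show ?case
    proof
      fix p assume "p \<in> a \<inter> b"
      then obtain W W' where "W \<in> vertex_base V E" "p \<in> W" "W \<subseteq> a"
        "W' \<in> vertex_base V E" "p \<in> W'" "W' \<subseteq> b" using Int.IH by blast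
      then show "\<exists>W\<in>vertex_base V E. p \<in> W \<and> W \<subseteq> a \<inter> b"
        by (intro bexI[of _ "W \<inter> W'"]) (auto intro: vertex_base_Int)
    qed
  next
    case (UN K)
    show ?case
    proof
      fix p assume "p \<in> \<Union>K"
      then obtain k where "k \<in> K" "p \<in> k" by blast
      then obtain W where "W \<in> vertex_base V E" "p \<in> W" "W \<subseteq> k" using UN.IH by blast
      then show "\<exists>W\<in>vertex_base V E. p \<in> W \<and> W \<subseteq> \<Union>K"
        using \<open>k \<in> K\<close> by (intro bexI[of _ W]) auto
    qed
  qed auto
  then show "\<exists>\<U> \<subseteq> vertex_base V E. U = \<Union>\<U>"
    by (intro exI[of _ "{W \<in> vertex_base V E. W \<subseteq> U}"] conjI) auto
next
  assume "\<exists>\<U> \<subseteq> vertex_base V E. U = \<Union>\<U>"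
  then obtain \<U> where \<U>: "\<U> \<subseteq> vertex_base V E" "U = \<Union>\<U>" by blast
  have "openin (vertex_topology V E) W" if "W \<in> \<U>" for W
    unfolding vertex_topology_def
    by (rule topology_generated_by_Basis) (use \<U>(1) that in auto)
  then show "openin (vertex_topology V E) U" unfolding \<U>(2) by (rule openin_Union)
qed

end

theory Submission
  imports Defs
begin

text \<open>The T0 property holds because \<open>V - {v}\<close> has finite boundary for every vertex \<open>v\<close> and
  because a cut separating two rays separates their ends.

  For compactness, let \<open>F\<close> be the family of all \<open>e\<close> with finite boundary whose basic open set is
  covered by finitely many members of a given open cover; it is closed under finite unions. Suppose
  \<open>V \<notin> F\<close>. Starting with a nonempty member, choose \<open>e\<^sub>n \<in> F\<close> such that \<open>e\<^sub>n\<^sub>+\<^sub>1\<close> contains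
  \<open>e\<^sub>n\<close> and its boundary. The union of the \<open>e\<^sub>n\<close> has empty boundary, so it is \<open>V\<close> by
  connectedness. Every component of the complement of \<open>e\<^sub>n\<close> meets the finite boundary of \<open>e\<^sub>n\<close>, so
  there are finitely many of them, and one obtains a decreasing sequence of connected sets \<open>C\<^sub>n\<close>,
  disjoint from \<open>e\<^sub>n\<close> and contained in no member of \<open>F\<close>. Some ray lies in every \<open>C\<^sub>n\<close>, and
  it also lies in some \<open>e \<in> F\<close>. For large \<open>n\<close> the boundary of \<open>e\<close> is contained in \<open>e\<^sub>n\<close>; then
  the connected set \<open>C\<^sub>n\<close> is either contained in \<open>e\<close> or disjoint from it, and both are impossible.\<close>

section \<open>Connected vertex sets and their boundaries\<close>

definition induced_adjacent :: "'v set set \<Rightarrow> 'v set \<Rightarrow> 'v \<Rightarrow> 'v \<Rightarrow> bool" where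
  "induced_adjacent E A u v \<longleftrightarrow> u \<in> A \<and> v \<in> A \<and> adjacent E u v"

text \<open>The empty set counts as connected. In the descent below, the sets \<open>C n\<close> are
  nonempty because they lie in no member of \<open>F\<close>, while
  \<open>{} \<in> F\<close>.\<close>

definition induces_connected :: "'v set set \<Rightarrow> 'v set \<Rightarrow> bool" where
  "induces_connected E A \<longleftrightarrow> (\<forall>u\<in>A. \<forall>v\<in>A. (induced_adjacent E A)\<^sup>*\<^sup>* u v)"

lemma adjacent_commute: "adjacent E u v \<longleftrightarrow> adjacent E v u"
  by (simp add: adjacent_def insert_commute)

lemma induced_adjacent_rtranclp_sym:
  assumes "(induced_adjacent E A)\<^sup>*\<^sup>* u v"
  shows "(induced_adjacent E A)\<^sup>*\<^sup>* v u"
proof -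
  have "symp (induced_adjacent E A)"
    by (auto simp: symp_def induced_adjacent_def adjacent_commute)
  then show ?thesis
    using assms by (metis symp_rtranclp sympD)
qed

lemma induces_connected_carrier:
  assumes "simple_graph V E" "connected_graph V E"
  shows "induces_connected E V"
proof -
  have "adjacent E = induced_adjacent E V"
    using assms(1) by (fastforce simp: fun_eq_iff induced_adjacent_def adjacent_def simple_graph_def)
  then show ?thesis
    using assms(2) by (simp add: induces_connected_def connected_graph_def)
qed

text \<open>Every vertex on a path from \<open>u\<close> in \<open>A\<close> is itself reachable
  from \<open>u\<close>, so the path stays inside the component.\<close>

lemma induces_connected_reachable:
  "induces_connected E {w. (induced_adjacent E A)\<^sup>*\<^sup>* u w}" (is "induces_connected E ?D")
proof -
  have from_u: "(induced_adjacent E ?D)\<^sup>*\<^sup>* u w" if "(induced_adjacent E A)\<^sup>*\<^sup>* u w" for w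
    using that
  proof (induction rule: rtranclp_induct)
    case base
    then show ?case by simp
  next
    case (step y z)
    then have "(induced_adjacent E A)\<^sup>*\<^sup>* u z"
      by (meson rtranclp.rtrancl_into_rtrancl)
    then have "induced_adjacent E ?D y z"
      using step.hyps by (auto simp: induced_adjacent_def)
    with step.IH show ?case by (meson rtranclp.rtrancl_into_rtrancl)
  qed
  show ?thesis
    unfolding induces_connected_def
    using from_u induced_adjacent_rtranclp_sym rtranclp_trans by (metis mem_Collect_eq)
qed

text \<open>A path in \<open>C\<close> that starts in \<open>e\<close> and leaves it would first
  step onto a boundary vertex of \<open>e\<close>.\<close>

lemma induces_connected_subset_if_no_boundary:
  assumes conn: "induces_connected E C" and "C \<subseteq> V" and "C \<inter> vertex_boundary V E e = {}"
    and "C \<inter> e \<noteq> {}"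
  shows "C \<subseteq> e"
proof
  fix w assume "w \<in> C"
  obtain u where u: "u \<in> C" "u \<in> e" using assms(4) by blast
  then have "(induced_adjacent E C)\<^sup>*\<^sup>* u w"
    using conn \<open>w \<in> C\<close> by (auto simp: induces_connected_def)
  then show "w \<in> e"
  proof (induction rule: rtranclp_induct)
    case base
    show ?case by (rule u(2))
  next
    case (step y z)
    then show ?case
      using assms(2,3) by (auto simp: induced_adjacent_def vertex_boundary_def)
  qed
qed

text \<open>After its last visit to \<open>e\<close>, a path in \<open>C\<close> from
  \<open>e\<close> to \<open>w\<close> continues from a boundary vertex inside \<open>C - e\<close>.
  Hence \<open>C - e\<close> has at most as many components as \<open>e\<close> has boundary
  vertices.\<close>

lemma boundary_reaches:
  assumes conn: "induces_connected E C" and "C \<subseteq> V" and "C \<inter> e \<noteq> {}" and "w \<in> C - e"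
  shows "\<exists>u \<in> vertex_boundary V E e \<inter> C. (induced_adjacent E (C - e))\<^sup>*\<^sup>* u w"
proof -
  obtain v where v: "v \<in> C" "v \<in> e" using assms(3) by blast
  have "(induced_adjacent E C)\<^sup>*\<^sup>* v w"
    using conn v(1) assms(4) by (auto simp: induces_connected_def)
  \<comment> \<open>The implication lets the induction run through vertices of \<open>e\<close>;
    whenever the path leaves \<open>e\<close>, the exit vertex becomes the new witness.\<close>
  then have "w \<notin> e \<longrightarrow> ?thesis"
  proof (induction rule: rtranclp_induct)
    case base
    then show ?case using v by simp
  next
    case (step y z)
    show ?case
    proof (cases "y \<in> e")
      case True
      then have "z \<notin> e \<longrightarrow> z \<in> vertex_boundary V E e \<inter> C"
        using step.hyps(2) assms(2) by (auto simp: induced_adjacent_def vertex_boundary_def)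
      then show ?thesis by blast
    next
      case False
      then have "z \<notin> e \<longrightarrow> induced_adjacent E (C - e) y z"
        using step.hyps(2) by (auto simp: induced_adjacent_def)
      with False step.IH show ?thesis by (meson rtranclp.rtrancl_into_rtrancl)
    qed
  qed
  with assms(4) show ?thesis by blast
qed

section \<open>Rays through decreasing connected sets\<close>

text \<open>A vertex \<open>v\<close> has a level, the last \<open>n\<close> with \<open>v \<in> C n\<close>, and a distance to \<open>C (Suc n)\<close>
  within \<open>C n\<close>. Moving to a neighbour that decreases the distance either keeps the level or raises
  it, so the resulting walk never revisits a vertex.\<close>

lemma ray_in_decreasing_connected_sets:
  assumes sub: "\<And>n. C (Suc n) \<subseteq> C n" and conn: "\<And>n. induces_connected E (C n)"
    and ne: "\<And>n. C n \<noteq> {}" and V: "C 0 \<subseteq> V" and empty: "(\<Inter>n. C n) = {}"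
  shows "\<exists>x\<in>rays V E. \<forall>n. ray_lies_in x (C n)"
proof -
  have mono: "C n \<subseteq> C m" if "m \<le> n" for m n
    using lift_Suc_antimono_le[of C, OF sub that] .
  \<comment> \<open>The minimum exists because the intersection is empty; for
    \<open>v \<in> C 0\<close> the shift by \<open>Suc\<close> makes it the last index of a set
    containing \<open>v\<close>.\<close>
  define lev where "lev v = (LEAST n. v \<notin> C (Suc n))" for v
  have lev: "v \<in> C n \<longleftrightarrow> n \<le> lev v" if v: "v \<in> C 0" for v n
  proof -
    obtain m where "v \<notin> C m" using empty by blast
    then have "v \<notin> C (Suc m)" using sub by blast
    then have out: "v \<notin> C (Suc (lev v))" unfolding lev_def by (rule LeastI)
    have "v \<in> C (lev v)"
    proof (cases "lev v")
      case 0
      then show ?thesis using v by simp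
    next
      case (Suc k)
      then show ?thesis using not_less_Least[of k "\<lambda>n. v \<notin> C (Suc n)"] by (simp add: lev_def)
    qed
    with out show ?thesis using mono by (meson not_less_eq_eq subsetD)
  qed
  define reaches where
    "reaches v k \<longleftrightarrow> (\<exists>z \<in> C (Suc (lev v)). (induced_adjacent E (C (lev v)) ^^ k) v z)" for v k
  define dst where "dst v = (LEAST k. reaches v k)" for v
  \<comment> \<open>This is a strict lexicographic order, so a walk that advances along it at every
    step is injective.\<close>
  define before where
    "before u v \<longleftrightarrow> lev u < lev v \<or> lev u = lev v \<and> dst v < dst u" for u v
  have next_vertex: "\<exists>w. w \<in> C 0 \<and> adjacent E v w \<and> before v w" if v: "v \<in> C 0" for v
  proof -
    obtain z where z: "z \<in> C (Suc (lev v))" using ne by blast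
    moreover have "v \<in> C (lev v)" using lev[OF v] by simp
    ultimately have "(induced_adjacent E (C (lev v)))\<^sup>*\<^sup>* v z"
      using conn[of "lev v"] sub unfolding induces_connected_def by blast
    then have "\<exists>k. reaches v k"
      using z unfolding reaches_def by (meson rtranclp_imp_relpowp)
    then have "reaches v (dst v)" unfolding dst_def by (rule LeastI_ex)
    then obtain t where t: "t \<in> C (Suc (lev v))"
      and path: "(induced_adjacent E (C (lev v)) ^^ dst v) v t"
      unfolding reaches_def by blast
    have "dst v \<noteq> 0"
    proof
      assume "dst v = 0"
      then have "v = t" using path by simp
      then show False using t lev[OF v] by simp
    qed
    then obtain k where k: "dst v = Suc k" by (cases "dst v") auto
    \<comment> \<open>\<open>w\<close> is the second vertex of a shortest path. It remains in
      \<open>C (lev v)\<close>, so the level does not drop; if the level is unchanged, the rest of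
      the path bounds the distance of \<open>w\<close> by \<open>k\<close>.\<close>
    then obtain w where w: "induced_adjacent E (C (lev v)) v w"
      and rest: "(induced_adjacent E (C (lev v)) ^^ k) w t"
      using path by (metis relpowp_Suc_D2)
    then have w0: "w \<in> C 0" using mono by (auto simp: induced_adjacent_def)
    have "lev v \<le> lev w" using w lev[OF w0] by (simp add: induced_adjacent_def)
    moreover have "dst w < dst v" if "lev v = lev w"
    proof -
      have "reaches w k" unfolding reaches_def using that t rest by auto
      then have "dst w \<le> k" unfolding dst_def by (rule Least_le)
      then show ?thesis using k by simp
    qed
    ultimately show ?thesis
      using w w0 by (auto simp: before_def induced_adjacent_def)
  qed
  obtain x where x0: "\<And>n. x n \<in> C 0" and adj: "\<And>n. adjacent E (x n) (x (Suc n))"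
    and bef: "\<And>n. before (x n) (x (Suc n))"
  proof -
    have "\<exists>x. \<forall>n. x n \<in> C 0 \<and> (adjacent E (x n) (x (Suc n)) \<and> before (x n) (x (Suc n)))"
    proof (rule dependent_nat_choice)
      show "\<exists>v. v \<in> C 0" using ne by blast
    qed (use next_vertex in blast)
    then show ?thesis using that by blast
  qed
  have before_less: "before (x m) (x n)" if "m < n" for m n
    using that
  proof (induction n)
    case (Suc n)
    then show ?case
      using bef[of n] by (cases "m = n") (auto simp: before_def less_Suc_eq)
  qed simp
  have "inj x"
    by (rule linorder_injI) (use before_less in \<open>force simp: before_def\<close>)
  then have ray: "x \<in> rays V E"
    using x0 V adj by (auto simp: rays_def)
  \<comment> \<open>While the level stays constant, the distance strictly decreases in
    \<open>nat\<close>, so the level must eventually rise.\<close>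
  have rises: "\<exists>n\<ge>m. lev (x m) < lev (x n)" for m
  proof (induction "dst (x m)" arbitrary: m rule: less_induct)
    case less
    show ?case
    proof (cases "lev (x m) < lev (x (Suc m))")
      case True
      then show ?thesis by (meson le_SucI order_refl)
    next
      case False
      then have "lev (x m) = lev (x (Suc m))" "dst (x (Suc m)) < dst (x m)"
        using bef[of m] by (auto simp: before_def)
      with less[of "Suc m"] show ?thesis using Suc_leD by metis
    qed
  qed
  have unbounded: "\<exists>m. n \<le> lev (x m)" for n
  proof (induction n)
    case (Suc n)
    then show ?case using rises by (meson Suc_leI le_less_trans)
  qed simp
  have "ray_lies_in x (C n)" for n
  proof -
    obtain m where m: "n \<le> lev (x m)" using unbounded by blast
    have "x k \<in> C n" if "m \<le> k" for k
    proof -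
      have "lev (x m) \<le> lev (x k)"
        using before_less[of m k] that by (cases "m = k") (auto simp: before_def)
      then show ?thesis using m lev[OF x0] by simp
    qed
    then have "{k. x k \<notin> C n} \<subseteq> {..<m}" using not_le by auto
    then show ?thesis unfolding ray_lies_in_def using finite_subset by blast
  qed
  with ray show ?thesis by blast
qed

section \<open>Exhaustion and descent within a family of cuts\<close>

text \<open>A vertex of \<open>V\<close> outside \<open>e n\<close> but adjacent to it lies in its
  boundary, hence in \<open>e (Suc n)\<close>; so the union has no boundary.\<close>

lemma connected_cover_exhaustion:
  assumes conn: "induces_connected E V" and "e 0 \<inter> V \<noteq> {}"
    and step: "\<And>n. e n \<union> vertex_boundary V E (e n) \<subseteq> e (Suc n)"
  shows "V \<subseteq> (\<Union>n. e n)"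
proof (rule induces_connected_subset_if_no_boundary[OF conn order_refl])
  show "V \<inter> vertex_boundary V E (\<Union>n. e n) = {}"
    using step by (fastforce simp: vertex_boundary_def)
  show "V \<inter> (\<Union>n. e n) \<noteq> {}" using assms(2) by blast
qed

text \<open>Containment, not membership, is claimed because the sets \<open>g a\<close> need not
  belong to \<open>F\<close>. The lemma serves for components, for single boundary vertices and for
  an increasing sequence.\<close>

lemma finite_union_closed_subset:
  assumes "finite A" and "{} \<in> F" and "\<And>e f. e \<in> F \<Longrightarrow> f \<in> F \<Longrightarrow> e \<union> f \<in> F"
    and "\<And>a. a \<in> A \<Longrightarrow> \<exists>e\<in>F. g a \<subseteq> e"
  shows "\<exists>e\<in>F. (\<Union>a\<in>A. g a) \<subseteq> e"
  using assms(1,4)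
proof (induction A rule: finite_induct)
  case empty
  show ?case by (rule bexI[OF _ assms(2)]) simp
next
  case (insert a A)
  obtain e where "e \<in> F" "(\<Union>a\<in>A. g a) \<subseteq> e" using insert.IH insert.prems by blast
  moreover obtain f where "f \<in> F" "g a \<subseteq> f" using insert.prems by blast
  ultimately show ?case using assms(3)[of f e] by (intro bexI[of _ "f \<union> e"]) auto
qed

text \<open>If each component of \<open>C - e\<close> lay in a member of \<open>F\<close>, then,
  being finitely many, they would all lie in one \<open>f \<in> F\<close>, and
  \<open>e \<union> f\<close> would contain \<open>C\<close>. If \<open>C\<close> misses
  \<open>e\<close>, then \<open>C\<close> itself serves as \<open>D\<close>.\<close>

lemma unbounded_connected_subset:
  assumes "induces_connected E C" "C \<subseteq> V" "e \<in> F" "finite (vertex_boundary V E e)"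
    and empty: "{} \<in> F" and Un: "\<And>e f. e \<in> F \<Longrightarrow> f \<in> F \<Longrightarrow> e \<union> f \<in> F"
    and large: "\<And>f. f \<in> F \<Longrightarrow> \<not> C \<subseteq> f"
  shows "\<exists>D. D \<subseteq> C - e \<and> induces_connected E D \<and> (\<forall>f\<in>F. \<not> D \<subseteq> f)"
proof (cases "C \<inter> e = {}")
  case True
  then show ?thesis using assms(1) large by (intro exI[of _ C]) auto
next
  case False
  show ?thesis
  proof (rule ccontr)
    assume no: "\<not> ?thesis"
    define comp where "comp u = {w. (induced_adjacent E (C - e))\<^sup>*\<^sup>* u w}" for u
    have "\<exists>f\<in>F. comp u \<subseteq> f" if u: "u \<in> vertex_boundary V E e \<inter> C" for u
    proof -
      have "w \<in> C - e" if "(induced_adjacent E (C - e))\<^sup>*\<^sup>* u w" for w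
        using that u by (induction rule: rtranclp_induct)
          (auto simp: induced_adjacent_def vertex_boundary_def)
      then have "comp u \<subseteq> C - e" by (auto simp: comp_def)
      moreover have "induces_connected E (comp u)"
        unfolding comp_def by (rule induces_connected_reachable)
      ultimately show ?thesis using no by blast
    qed
    then obtain f where f: "f \<in> F" "(\<Union>u \<in> vertex_boundary V E e \<inter> C. comp u) \<subseteq> f"
      using finite_union_closed_subset[of "vertex_boundary V E e \<inter> C" F comp] assms(4) empty Un
      by blast
    have "C - e \<subseteq> (\<Union>u \<in> vertex_boundary V E e \<inter> C. comp u)"
      using boundary_reaches[OF assms(1,2) False] by (auto simp: comp_def)
    then have "C \<subseteq> e \<union> f" using f(2) by blast
    then show False using large Un[OF assms(3) f(1)] by blast
  qed
qed

text \<open>This is the combinatorial core of compactness, free of topology; \<open>rays\<close>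
  stands in for the covering of the ends.\<close>

lemma cut_family_contains_carrier:
  assumes conn: "induces_connected E V"
    and fin: "\<And>e. e \<in> F \<Longrightarrow> finite (vertex_boundary V E e)"
    and empty: "{} \<in> F" and Un: "\<And>e f. e \<in> F \<Longrightarrow> f \<in> F \<Longrightarrow> e \<union> f \<in> F"
    and cover: "V \<subseteq> \<Union>F"
    and rays: "\<And>x. x \<in> rays V E \<Longrightarrow> \<exists>e\<in>F. ray_lies_in x e"
  shows "\<exists>e\<in>F. V \<subseteq> e"
proof (rule ccontr)
  assume "\<not> (\<exists>e\<in>F. V \<subseteq> e)"
  then have large: "\<And>f. f \<in> F \<Longrightarrow> \<not> V \<subseteq> f" by blast
  obtain e0 where e0: "e0 \<in> F" "e0 \<inter> V \<noteq> {}"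
    using large[OF empty] cover by blast
  have enlarge: "\<exists>f\<in>F. e \<union> vertex_boundary V E e \<subseteq> f" if e: "e \<in> F" for e
  proof -
    have "\<exists>f\<in>F. (\<Union>v\<in>vertex_boundary V E e. {v}) \<subseteq> f"
    proof (rule finite_union_closed_subset[OF fin[OF e] empty Un])
      fix v assume "v \<in> vertex_boundary V E e"
      then show "\<exists>f\<in>F. {v} \<subseteq> f" using cover by (auto simp: vertex_boundary_def)
    qed
    then obtain f where "f \<in> F" "vertex_boundary V E e \<subseteq> f" by auto
    then show ?thesis using Un[OF e] by (intro bexI[of _ "e \<union> f"]) auto
  qed
  \<comment> \<open>The exhausting set and the connected set are chosen together as a pair:
    \<open>good\<close> is the invariant of one pair, \<open>succ\<close> relates consecutive
    pairs.\<close>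
  define good where "good p \<longleftrightarrow> fst p \<in> F \<and> fst p \<inter> V \<noteq> {} \<and> snd p \<subseteq> V - fst p \<and>
    induces_connected E (snd p) \<and> (\<forall>f\<in>F. \<not> snd p \<subseteq> f)" for p
  define succ where "succ p q \<longleftrightarrow> fst p \<union> vertex_boundary V E (fst p) \<subseteq> fst q \<and>
    snd q \<subseteq> snd p" for p q :: "'a set \<times> 'a set"
  have "\<exists>p. \<forall>n. good (p n) \<and> succ (p n) (p (Suc n))"
  proof (rule dependent_nat_choice)
    obtain D where "D \<subseteq> V - e0" "induces_connected E D" "\<forall>f\<in>F. \<not> D \<subseteq> f"
      using unbounded_connected_subset[OF conn order_refl e0(1) fin[OF e0(1)] empty Un large]
      by blast
    then have "good (e0, D)" using e0 by (auto simp: good_def)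
    then show "\<exists>p. good p" by blast
  next
    fix p n assume p: "good p"
    then obtain f where f: "f \<in> F" "fst p \<union> vertex_boundary V E (fst p) \<subseteq> f"
      using enlarge[of "fst p"] unfolding good_def by blast
    have C: "induces_connected E (snd p)" "snd p \<subseteq> V" "\<And>f. f \<in> F \<Longrightarrow> \<not> snd p \<subseteq> f"
      using p by (auto simp: good_def)
    \<comment> \<open>The next connected set is cut out of the current one by removing the enlarged
      set \<open>f\<close>, which keeps the pair disjoint and both sequences monotone.\<close>
    obtain D where "D \<subseteq> snd p - f" "induces_connected E D" "\<forall>f\<in>F. \<not> D \<subseteq> f"
      using unbounded_connected_subset[OF C(1,2) f(1) fin[OF f(1)] empty Un C(3)] by blast
    then have "good (f, D) \<and> succ p (f, D)"
      using p f C(2) by (auto simp: good_def succ_def)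
    then show "\<exists>q. good q \<and> succ p q" by blast
  qed
  then obtain p where p: "\<And>n. good (p n)" "\<And>n. succ (p n) (p (Suc n))" by blast
  define e where "e n = fst (p n)" for n
  define C where "C n = snd (p n)" for n
  have eF: "e n \<in> F" and CV: "C n \<subseteq> V" and disj: "C n \<inter> e n = {}"
    and Cconn: "induces_connected E (C n)" and Clarge: "\<And>f. f \<in> F \<Longrightarrow> \<not> C n \<subseteq> f" for n
    using p(1)[of n] by (auto simp: good_def e_def C_def)
  have estep: "e n \<union> vertex_boundary V E (e n) \<subseteq> e (Suc n)" and Cstep: "C (Suc n) \<subseteq> C n" for n
    using p(2)[of n] by (auto simp: succ_def e_def C_def)
  have "e 0 \<inter> V \<noteq> {}" using p(1)[of 0] by (simp add: good_def e_def)
  from connected_cover_exhaustion[of E V e, OF conn this estep]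
  have exhaust: "V \<subseteq> (\<Union>n. e n)" .
  have emono: "e m \<subseteq> e n" if "m \<le> n" for m n
    using lift_Suc_mono_le[of e, OF _ that] estep by blast
  have ne: "C n \<noteq> {}" for n using Clarge[OF empty, of n] by blast
  have "v \<notin> (\<Inter>n. C n)" for v
  proof
    assume v: "v \<in> (\<Inter>n. C n)"
    then have "v \<in> V" using CV[of 0] by blast
    then obtain n where "v \<in> e n" using exhaust by blast
    then show False using v disj[of n] by blast
  qed
  then have "(\<Inter>n. C n) = {}" by blast
  from ray_in_decreasing_connected_sets[of C E V, OF Cstep Cconn ne CV this]
  obtain x where x: "x \<in> rays V E" "\<And>n. ray_lies_in x (C n)" by blast
  obtain f where f: "f \<in> F" "ray_lies_in x f" using rays[OF x(1)] by blast
  have "\<exists>n. (\<Union>v\<in>vertex_boundary V E f. {v}) \<subseteq> e n"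
  proof -
    \<comment> \<open>The range of the increasing sequence \<open>e\<close> is closed under unions;
      \<open>{}\<close> is adjoined to meet the requirement of
      \<open>finite_union_closed_subset\<close>.\<close>
    have "\<exists>g\<in>insert {} (range e). (\<Union>v\<in>vertex_boundary V E f. {v}) \<subseteq> g"
    proof (rule finite_union_closed_subset[OF fin[OF f(1)]])
      fix g h assume "g \<in> insert {} (range e)" "h \<in> insert {} (range e)"
      moreover have "e m \<union> e n = e (max m n)" for m n
        using emono[of m n] emono[of n m] by (cases "m \<le> n") (auto simp: max_def)
      ultimately show "g \<union> h \<in> insert {} (range e)" by auto
    qed (use exhaust in \<open>auto simp: vertex_boundary_def\<close>)
    then show ?thesis by auto
  qed
  then obtain n where "vertex_boundary V E f \<subseteq> e n" by auto
  then have "C n \<inter> vertex_boundary V E f = {}" using disj[of n] by blast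
  then have "C n \<inter> f = {}"
    using induces_connected_subset_if_no_boundary[OF Cconn[of n] CV] Clarge[OF f(1), of n] by blast
  then have "C n \<subseteq> V - f" using CV[of n] by blast
  then have "ray_lies_in x (V - f)"
    using x(2)[of n] finite_subset[of "{k. x k \<notin> V - f}" "{k. x k \<notin> C n}"]
    by (auto simp: ray_lies_in_def)
  then show False using ray_not_lies_in_both f(2) by blast
qed

section \<open>Ends and the cuts containing them\<close>

text \<open>One ray decides for the whole end: any other ray of the end lies in \<open>e\<close> or
  in \<open>V - e\<close>, and in the latter case \<open>e\<close> would separate it from
  \<open>x\<close>.\<close>

lemma vertex_end_lies_in_iff:
  assumes "\<omega> \<in> vertex_ends V E" "x \<in> \<omega>" "e \<subseteq> V" "finite (vertex_boundary V E e)"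
  shows "\<omega> \<in> ends_in V E e \<longleftrightarrow> ray_lies_in x e"
proof
  assume x: "ray_lies_in x e"
  have "ray_lies_in y e" if y: "y \<in> \<omega>" for y
  proof -
    have "(x, y) \<in> vertex_equivalence V E"
      using assms(1,2) y equiv_vertex_equivalence[of V E] unfolding vertex_ends_def
      by (meson quotient_eq_iff)
    then have yr: "y \<in> rays V E" and ns: "\<And>e. vertex_cut V E e \<Longrightarrow> \<not> separates V e x y"
      by (auto simp: vertex_equivalence_def)
    \<comment> \<open>A vertex-cut must be nonempty, and no ray lies in the empty set.\<close>
    have "e \<noteq> {}" using x by (auto simp: ray_lies_in_def)
    then have "\<not> separates V e x y" using ns assms(3,4) by (auto simp: vertex_cut_def)
    then show ?thesis
      using x ray_lies_in_or_complement[OF yr assms(4)] by (auto simp: separates_def)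
  qed
  then show "\<omega> \<in> ends_in V E e" using assms(1) by (auto simp: ends_in_def)
qed (use assms(2) in \<open>auto simp: ends_in_def\<close>)

lemma vertex_end_ray:
  assumes "\<omega> \<in> vertex_ends V E"
  obtains x where "x \<in> rays V E" "x \<in> \<omega>"
  using assms equiv_class_self[OF equiv_vertex_equivalence[of V E]] unfolding vertex_ends_def
  by (auto elim!: quotientE)

lemma finite_vertex_boundary_Un:
  assumes "finite (vertex_boundary V E e)" "finite (vertex_boundary V E f)"
  shows "finite (vertex_boundary V E (e \<union> f))"
proof (rule finite_subset)
  show "vertex_boundary V E (e \<union> f) \<subseteq> vertex_boundary V E e \<union> vertex_boundary V E f"
    by (auto simp: vertex_boundary_def)
qed (use assms in blast)

text \<open>A ray in \<open>e \<union> f\<close> that does not lie in \<open>e\<close> lies in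
  \<open>V - e\<close>, hence in \<open>f\<close>. This makes the finitely covered cuts closed under
  union.\<close>

lemma ends_in_Un_subset:
  assumes "e \<subseteq> V" "finite (vertex_boundary V E e)" "f \<subseteq> V" "finite (vertex_boundary V E f)"
  shows "ends_in V E (e \<union> f) \<subseteq> ends_in V E e \<union> ends_in V E f"
proof
  fix \<omega> assume \<omega>: "\<omega> \<in> ends_in V E (e \<union> f)"
  then have end_\<omega>: "\<omega> \<in> vertex_ends V E" by (simp add: ends_in_def)
  then obtain x where x: "x \<in> rays V E" "x \<in> \<omega>" by (rule vertex_end_ray)
  have "ray_lies_in x (e \<union> f)" using \<omega> x(2) by (simp add: ends_in_def)
  moreover have "{n. x n \<notin> f} \<subseteq> {n. x n \<notin> e \<union> f} \<union> {n. x n \<notin> V - e}" by blast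
  ultimately have "ray_lies_in x (V - e) \<Longrightarrow> ray_lies_in x f"
    unfolding ray_lies_in_def by (meson finite_UnI finite_subset)
  then have "ray_lies_in x e \<or> ray_lies_in x f"
    using ray_lies_in_or_complement[OF x(1) assms(2)] by blast
  then show "\<omega> \<in> ends_in V E e \<union> ends_in V E f"
    using vertex_end_lies_in_iff[OF end_\<omega> x(2)] assms by blast
qed

section \<open>Compactness\<close>

lemma compact_space_vertex_topology:
  assumes "simple_graph V E" "connected_graph V E"
  shows "compact_space (vertex_topology V E)"
  unfolding compact_space_alt
proof (intro allI impI, elim conjE)
  fix \<U>
  assume opn: "\<forall>U\<in>\<U>. openin (vertex_topology V E) U"
    and cov: "topspace (vertex_topology V E) \<subseteq> \<Union>\<U>"
  define B where "B e = Inl ` e \<union> Inr ` ends_in V E e" for e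
  define F where "F = {e. e \<subseteq> V \<and> finite (vertex_boundary V E e) \<and>
    (\<exists>\<D>. finite \<D> \<and> \<D> \<subseteq> \<U> \<and> B e \<subseteq> \<Union>\<D>)}"
  have point: "\<exists>e\<in>F. p \<in> B e" if p: "p \<in> topspace (vertex_topology V E)" for p
  proof -
    obtain U where U: "U \<in> \<U>" "p \<in> U" using p cov by blast
    then obtain W where W: "W \<in> vertex_base V E" "p \<in> W" "W \<subseteq> U"
      using opn openin_vertex_topology[of V E U] by blast
    then obtain e where e: "W = B e" "e \<subseteq> V" "finite (vertex_boundary V E e)"
      by (auto simp: vertex_base_def B_def)
    have "e \<in> F"
      using e W(3) U(1) by (auto simp: F_def intro!: exI[of _ "{U}"])
    then show ?thesis using W(2) e(1) by blast
  qed
  have "\<exists>e\<in>F. V \<subseteq> e"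
  proof (rule cut_family_contains_carrier[OF induces_connected_carrier[OF assms]])
    show "finite (vertex_boundary V E e)" if "e \<in> F" for e
      using that by (simp add: F_def)
    show "{} \<in> F"
    proof -
      \<comment> \<open>Every end contains a ray, and no ray lies in the empty set.\<close>
      have "ends_in V E {} = {}"
        by (auto simp: ends_in_def ray_lies_in_def) (meson all_not_in_conv vertex_end_ray)
      then have "B {} \<subseteq> \<Union>{}" by (simp add: B_def)
      then show ?thesis by (auto simp: F_def vertex_boundary_def)
    qed
    show "e \<union> f \<in> F" if ef: "e \<in> F" "f \<in> F" for e f
    proof -
      have e: "e \<subseteq> V" "finite (vertex_boundary V E e)" and f: "f \<subseteq> V" "finite (vertex_boundary V E f)"
        using ef by (simp_all add: F_def)
      obtain \<D> where \<D>: "finite \<D>" "\<D> \<subseteq> \<U>" "B e \<subseteq> \<Union>\<D>"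
        using ef(1) unfolding F_def by blast
      obtain \<D>' where \<D>': "finite \<D>'" "\<D>' \<subseteq> \<U>" "B f \<subseteq> \<Union>\<D>'"
        using ef(2) unfolding F_def by blast
      have "B (e \<union> f) \<subseteq> B e \<union> B f"
        using ends_in_Un_subset[OF e f] unfolding B_def by blast
      also have "\<dots> \<subseteq> \<Union>(\<D> \<union> \<D>')"
        unfolding Union_Un_distrib by (rule Un_mono[OF \<D>(3) \<D>'(3)])
      finally have "B (e \<union> f) \<subseteq> \<Union>(\<D> \<union> \<D>')" .
      then show ?thesis
        unfolding F_def using e f \<D> \<D>' finite_vertex_boundary_Un[OF e(2) f(2)]
        by (intro CollectI conjI exI[of _ "\<D> \<union> \<D>'"]) simp_all
    qed
    show "V \<subseteq> \<Union>F"
    proof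
      fix v assume "v \<in> V"
      then obtain e where "e \<in> F" "Inl v \<in> B e"
        using point[of "Inl v"] by (auto simp: topspace_vertex_topology)
      then show "v \<in> \<Union>F" by (auto simp: B_def)
    qed
    show "\<exists>e\<in>F. ray_lies_in x e" if x: "x \<in> rays V E" for x
    proof -
      let ?\<omega> = "vertex_equivalence V E `` {x}"
      have "?\<omega> \<in> vertex_ends V E" unfolding vertex_ends_def by (rule quotientI[OF x])
      then obtain e where "e \<in> F" "Inr ?\<omega> \<in> B e"
        using point[of "Inr ?\<omega>"] by (auto simp: topspace_vertex_topology)
      moreover have "x \<in> ?\<omega>" by (rule equiv_class_self[OF equiv_vertex_equivalence x])
      ultimately show ?thesis by (auto simp: B_def ends_in_def)
    qed
  qed
  then obtain e where "e \<in> F" "V \<subseteq> e" by blast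
  moreover from this have "e = V" by (simp add: F_def subset_antisym)
  ultimately have "V \<in> F" by simp
  moreover have "B V = topspace (vertex_topology V E)"
    by (simp add: B_def ends_in_carrier topspace_vertex_topology)
  ultimately show "\<exists>\<F>. finite \<F> \<and> \<F> \<subseteq> \<U> \<and> topspace (vertex_topology V E) \<subseteq> \<Union>\<F>"
    by (simp add: F_def)
qed

section \<open>Separation of points\<close>

lemma openin_vertex_basic:
  assumes "e \<subseteq> V" "finite (vertex_boundary V E e)"
  shows "openin (vertex_topology V E) (Inl ` e \<union> Inr ` ends_in V E e)"
  unfolding vertex_topology_def
  by (rule topology_generated_by_Basis) (use assms in \<open>auto simp: vertex_base_def\<close>)

text \<open>The boundary of \<open>V - {v}\<close> is at most \<open>{v}\<close>, and a ray, being
  injective, visits \<open>v\<close> at most once, so every end lies in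
  \<open>V - {v}\<close>.\<close>

lemma openin_vertex_topology_remove:
  "openin (vertex_topology V E) (Inl ` (V - {v}) \<union> Inr ` vertex_ends V E)"
proof -
  have fin: "finite (vertex_boundary V E (V - {v}))"
    by (rule finite_subset[of _ "{v}"]) (auto simp: vertex_boundary_def)
  moreover have "ends_in V E (V - {v}) = vertex_ends V E"
  proof -
    have "\<omega> \<in> ends_in V E (V - {v})" if \<omega>: "\<omega> \<in> vertex_ends V E" for \<omega>
    proof -
      obtain x where x: "x \<in> rays V E" "x \<in> \<omega>" using \<omega> by (rule vertex_end_ray)
      have "finite (x -` {v})" using x(1) by (intro finite_vimageI) (auto simp: rays_def)
      moreover have "{n. x n \<notin> V - {v}} \<subseteq> x -` {v}" using x(1) by (auto simp: rays_def)
      ultimately have "ray_lies_in x (V - {v})"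
        unfolding ray_lies_in_def using finite_subset by blast
      then show ?thesis
        using vertex_end_lies_in_iff[OF \<omega> x(2) _ fin] by blast
    qed
    then show ?thesis by (auto simp: ends_in_def)
  qed
  ultimately show ?thesis
    using openin_vertex_basic[of "V - {v}" V E] by simp
qed

lemma t0_space_vertex_topology: "t0_space (vertex_topology V E)"
  unfolding t0_space_def
proof (intro ballI impI)
  fix p q
  assume p: "p \<in> topspace (vertex_topology V E)" and q: "q \<in> topspace (vertex_topology V E)"
    and "p \<noteq> q"
  show "\<exists>U. openin (vertex_topology V E) U \<and> (p \<notin> U) = (q \<in> U)"
  proof (cases "p \<in> range Inl \<or> q \<in> range Inl")
    case True
    then obtain v where "p = Inl v \<or> q = Inl v" by blast
    \<comment> \<open>This open set omits only the point \<open>Inl v\<close>, so it contains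
      exactly one of \<open>p\<close> and \<open>q\<close>.\<close>
    then show ?thesis
      using p q \<open>p \<noteq> q\<close> openin_vertex_topology_remove[of V E v]
      by (intro exI[of _ "Inl ` (V - {v}) \<union> Inr ` vertex_ends V E"])
        (auto simp: topspace_vertex_topology)
  next
    case False
    then obtain \<omega> \<eta> where pq: "p = Inr \<omega>" "q = Inr \<eta>"
      and \<omega>: "\<omega> \<in> vertex_ends V E" and \<eta>: "\<eta> \<in> vertex_ends V E"
      using p q by (auto simp: topspace_vertex_topology)
    obtain x where x: "x \<in> rays V E" "x \<in> \<omega>" using \<omega> by (rule vertex_end_ray)
    obtain y where y: "y \<in> rays V E" "y \<in> \<eta>" using \<eta> by (rule vertex_end_ray)
    have "(x, y) \<notin> vertex_equivalence V E"
      using \<omega> \<eta> x y pq \<open>p \<noteq> q\<close> equiv_vertex_equivalence[of V E] unfolding vertex_ends_def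
      by (metis quotient_eqI)
    then obtain e where e: "e \<subseteq> V" "finite (vertex_boundary V E e)" "separates V e x y"
      using x(1) y(1) by (auto simp: vertex_equivalence_def vertex_cut_def)
    \<comment> \<open>The set \<open>V - e\<close> may have infinite boundary, so \<open>e\<close>
      yields a basic open set around only one of the two ends, and which one is not
      determined.\<close>
    then have "ray_lies_in x e \<longleftrightarrow> \<not> ray_lies_in y e"
      unfolding separates_def using ray_not_lies_in_both by blast
    then have "\<omega> \<in> ends_in V E e \<longleftrightarrow> \<eta> \<notin> ends_in V E e"
      using vertex_end_lies_in_iff[OF \<omega> x(2) e(1,2)] vertex_end_lies_in_iff[OF \<eta> y(2) e(1,2)]
      by blast
    then show ?thesis
      using openin_vertex_basic[OF e(1,2)] pq
      by (intro exI[of _ "Inl ` e \<union> Inr ` ends_in V E e"]) auto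
  qed
qed

theorem theorem1:
  fixes V :: "'v set" and E :: "'v set set"
  assumes "simple_graph V E" and "connected_graph V E"
  shows "compact_space (vertex_topology V E) \<and> t0_space (vertex_topology V E)"
  using compact_space_vertex_topology[OF assms] t0_space_vertex_topology by blast

end
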